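(* Let $\zeta\in\mathbb{C}$ be a primitive sixth root of unity. Let $r/s>1$ be an irreducible fraction with Hirzebruch--Jung continued fraction $r/s=[\![c_1,\dots,c_k]\!]$, and put $C_0=0$ and $C_i=c_1+\dots+c_i$ for $1\le i\le k$. Then \[ \mathcal{R}_{r/s}(\zeta)=\zeta^{C_k-2k}\sum_{i=0}^{k}(-1)^i\zeta^{-C_i} \quad\text{and}\quad \mathcal{S}_{r/s}(\zeta)=\zeta^{C_k-2k-1}\sum_{i=1}^{k}(-1)^i\zeta^{-C_i}. \]
   Context: Every irreducible fraction $r/s>1$ has a unique Hirzebruch--Jung expansion $r/s=[\![c_1,\dots,c_k]\!]=c_1-\cfrac{1}{c_2-\cfrac{1}{\ddots-\cfrac{1}{c_k}}}$ with all $c_i\ge 2$ integers. Put $R_q=\begin{pmatrix}q&1\\0&1\end{pmatrix}$, $S_q=\begin{pmatrix}0&-q^{-1}\\1&0\end{pmatrix}$ and $M_q(c_1,\dots,c_k)=R_q^{c_1}S_q\cdots R_q^{c_k}S_q$. For $r/s=[\![c_1,\dots,c_k]\!]>1$, the numerator $\mathcal{R}_{r/s}(q)\in\mathbb{Z}[q]$ and denominator $\mathcal{S}_{r/s}(q)\in\mathbb{Z}[q]$ of the $q$-deformed rational number $[r/s]_q=\mathcal{R}_{r/s}(q)/\mathcal{S}_{r/s}(q)$ are defined as the upper and lower entries, respectively, of the first column of $M_q(c_1,\dots,c_k)$. *)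

theory Defs
  imports Complex_Main
    "HOL-Computational_Algebra.Polynomial_Factorial"
    "Jordan_Normal_Form.Matrix"
begin

section \<open>Hirzebruch--Jung continued fractions\<close>

text \<open>The value for the empty list is a dummy; only nonempty lists occur below.\<close>

fun hj_value :: "nat list \<Rightarrow> rat" where
  "hj_value [] = 0"
| "hj_value [c] = of_nat c"
| "hj_value (c # d # cs) = of_nat c - 1 / hj_value (d # cs)"

definition is_hj_expansion :: "nat list \<Rightarrow> rat \<Rightarrow> bool" where
  "is_hj_expansion cs x \<longleftrightarrow> cs \<noteq> [] \<and> (\<forall>c\<in>set cs. c \<ge> 2) \<and> hj_value cs = x"

lemma hj_value_gt_1:
  "cs \<noteq> [] \<Longrightarrow> \<forall>c\<in>set cs. c \<ge> 2 \<Longrightarrow> hj_value cs > 1"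
proof (induction cs rule: hj_value.induct)
  case (3 c d cs)
  then have "hj_value (d # cs) > 1" by simp
  then have "1 / hj_value (d # cs) < 1" by simp
  moreover have "(of_nat c :: rat) \<ge> 2"
    using 3(3) by (metis list.set_intros(1) of_nat_le_iff of_nat_numeral)
  ultimately show ?case by simp
qed auto

lemma ceiling_hj_value:
  assumes "\<forall>c\<in>set (c # cs). c \<ge> 2"
  shows "\<lceil>hj_value (c # cs)\<rceil> = int c"
proof (cases cs)
  case (Cons d ds)
  then have "hj_value cs > 1" using assms by (intro hj_value_gt_1) auto
  then have "1 / hj_value cs < 1" "1 / hj_value cs > 0" by simp_all
  then show ?thesis using Cons by (simp add: ceiling_unique)
qed simp

lemma hj_value_inject:
  assumes "cs \<noteq> []" "\<forall>c\<in>set cs. c \<ge> 2" "ds \<noteq> []" "\<forall>d\<in>set ds. d \<ge> 2"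
    and "hj_value cs = hj_value ds"
  shows "cs = ds"
  using assms
proof (induction cs arbitrary: ds)
  case (Cons c cs)
  then obtain d ds' where ds: "ds = d # ds'" by (cases ds) auto
  have "int c = int d"
    using ceiling_hj_value[OF Cons.prems(2)] ceiling_hj_value[of d ds'] Cons.prems ds by simp
  then have cd: "c = d" by simp
  have pos: "hj_value xs > 1" if "xs \<noteq> []" "set xs \<subseteq> set cs \<union> set ds'" for xs
    using that Cons.prems ds by (intro hj_value_gt_1) auto
  have step: "hj_value (c # xs) = of_nat c - 1 / hj_value xs" for xs
    by (cases xs) auto
  have eq: "hj_value cs = hj_value ds'"
    using Cons.prems(5) unfolding ds cd[symmetric] step by simp
  show ?case
  proof (cases "cs = [] \<or> ds' = []")
    case True
    then show ?thesis using eq pos[of cs] pos[of ds'] ds cd by fastforce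
  next
    case False
    then show ?thesis using Cons.IH[of ds'] Cons.prems ds cd eq by auto
  qed
qed simp

lemma hj_expansion_unique:
  "is_hj_expansion cs x \<Longrightarrow> is_hj_expansion ds x \<Longrightarrow> cs = ds"
  unfolding is_hj_expansion_def by (elim conjE, rule hj_value_inject) simp_all

lemma hj_expansion_exists:
  assumes "0 < s" "s < (r :: int)"
  shows "\<exists>cs. is_hj_expansion cs (of_int r / of_int s)"
  using assms
proof (induction "nat s" arbitrary: r s rule: less_induct)
  case less
  define c where "c = \<lceil>(of_int r / of_int s :: rat)\<rceil>"
  define t where "t = c * s - r"
  have "(of_int r / of_int s :: rat) \<le> of_int c" unfolding c_def by simp
  then have "of_int r \<le> (of_int (c * s) :: rat)" using less.prems
    by (simp add: pos_divide_le_eq)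
  then have t0: "t \<ge> 0" unfolding t_def of_int_le_iff by simp
  have "of_int c - 1 < (of_int r / of_int s :: rat)" unfolding c_def by linarith
  then have "of_int ((c - 1) * s) < (of_int r :: rat)" using less.prems
    by (simp add: pos_less_divide_eq)
  then have ts: "t < s" unfolding t_def of_int_less_iff by (simp add: algebra_simps)
  have "c > 1"
  proof -
    have "(of_int r / of_int s :: rat) > 1" using less.prems by (simp add: divide_simps)
    then show ?thesis unfolding c_def by (simp add: less_ceiling_iff)
  qed
  then have c2: "nat c \<ge> 2" and cc: "of_nat (nat c) = (of_int c :: rat)" by auto
  have rs: "(of_int r / of_int s :: rat) = of_int c - of_int t / of_int s"
    using less.prems by (simp add: t_def diff_divide_distrib)
  show ?case
  proof (cases "t = 0")
    case True
    then have "is_hj_expansion [nat c] (of_int r / of_int s)"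
      using c2 cc rs by (simp add: is_hj_expansion_def)
    then show ?thesis by blast
  next
    case False
    then obtain cs where cs: "is_hj_expansion cs (of_int s / of_int t)"
      using less.hyps[of t s] t0 ts less.prems by auto
    then obtain d ds where "cs = d # ds"
      by (cases cs) (auto simp: is_hj_expansion_def)
    then have "is_hj_expansion (nat c # cs) (of_int r / of_int s)"
      using cs c2 cc rs by (auto simp: is_hj_expansion_def)
    then show ?thesis by blast
  qed
qed

lemma hj_expansion_ex1:
  assumes "(x :: rat) > 1"
  shows "\<exists>!cs. is_hj_expansion cs x"
proof (rule ex_ex1I)
  obtain r s where "x = of_int r / of_int s" "s > 0"
    by (metis Fract_of_int_quotient Rat_cases)
  moreover from this assms have "s < r" by (simp add: pos_less_divide_eq)
  ultimately show "\<exists>cs. is_hj_expansion cs x"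
    using hj_expansion_exists[of s r] by simp
qed (use hj_expansion_unique in blast)

definition hj_expansion :: "rat \<Rightarrow> nat list" where
  "hj_expansion x = (THE cs. is_hj_expansion cs x)"

lemma hj_expansion_eqI:
  "is_hj_expansion cs x \<Longrightarrow> hj_expansion x = cs"
  unfolding hj_expansion_def
  by (rule the_equality) (use hj_expansion_unique in blast)+


section \<open>The q-deformed rational numbers\<close>

text \<open>The matrices have entries in the field of fractions of \<open>\<int>[q]\<close>.\<close>

definition qvar :: "int poly fract" where
  "qvar = to_fract [:0, 1:]"

definition R_q :: "int poly fract mat" where
  "R_q = mat_of_rows_list 2 [[qvar, 1], [0, 1]]"

definition S_q :: "int poly fract mat" where
  "S_q = mat_of_rows_list 2 [[0, - inverse qvar], [1, 0]]"

primrec M_q :: "nat list \<Rightarrow> int poly fract mat" where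
  "M_q [] = 1\<^sub>m 2"
| "M_q (c # cs) = (R_q ^\<^sub>m c * S_q) * M_q cs"

text \<open>For \<open>x > 1\<close> both entries of the first column lie in \<open>\<int>[q]\<close>, so the definite
  descriptions are well defined; see \<open>to_fract_q_numerator_denominator\<close> below.\<close>

definition q_numerator :: "rat \<Rightarrow> int poly" where
  "q_numerator x = (THE P. to_fract P = M_q (hj_expansion x) $$ (0, 0))"

definition q_denominator :: "rat \<Rightarrow> int poly" where
  "q_denominator x = (THE P. to_fract P = M_q (hj_expansion x) $$ (1, 0))"

lemma R_q_carrier [simp]: "R_q \<in> carrier_mat 2 2"
  and S_q_carrier [simp]: "S_q \<in> carrier_mat 2 2"
  unfolding R_q_def S_q_def mat_of_rows_list_def by (rule carrier_matI; simp)+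

lemma M_q_carrier [simp]: "M_q cs \<in> carrier_mat 2 2"
  by (induction cs) (simp_all add: mult_carrier_mat[OF mult_carrier_mat[OF pow_carrier_mat[OF R_q_carrier] S_q_carrier]])

lemma qvar_nonzero [simp]: "qvar \<noteq> 0"
  by (simp add: qvar_def)

lemma mult_mat_2_index:
  assumes "A \<in> carrier_mat 2 2" "B \<in> carrier_mat 2 2" "i < 2" "j < 2"
  shows "(A * B) $$ (i, j) = A $$ (i, 0) * B $$ (0, j) + A $$ (i, 1) * B $$ (1, j)"
  using assms by (simp add: scalar_prod_def numeral_2_eq_2)

lemma R_q_index:
  "R_q $$ (0, 0) = qvar" "R_q $$ (0, 1) = 1" "R_q $$ (1, 0) = 0" "R_q $$ (1, 1) = 1"
  by (simp_all add: R_q_def mat_of_rows_list_def)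

lemma S_q_index:
  "S_q $$ (0, 0) = 0" "S_q $$ (0, 1) = - inverse qvar" "S_q $$ (1, 0) = 1" "S_q $$ (1, 1) = 0"
  by (simp_all add: S_q_def mat_of_rows_list_def)

lemma R_q_pow_index:
  "(R_q ^\<^sub>m n) $$ (0, 0) = qvar ^ n \<and> (R_q ^\<^sub>m n) $$ (0, 1) = (\<Sum>i<n. qvar ^ i) \<and>
   (R_q ^\<^sub>m n) $$ (1, 0) = 0 \<and> (R_q ^\<^sub>m n) $$ (1, 1) = 1"
proof (induction n)
  case 0
  have "dim_row R_q = 2" by (simp add: R_q_def mat_of_rows_list_def)
  then show ?case by simp
next
  case (Suc n)
  have step: "(R_q ^\<^sub>m Suc n) $$ (i, j) =
      (R_q ^\<^sub>m n) $$ (i, 0) * R_q $$ (0, j) + (R_q ^\<^sub>m n) $$ (i, 1) * R_q $$ (1, j)"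
    if "i < 2" "j < 2" for i j
    unfolding pow_mat.simps
    by (rule mult_mat_2_index[OF pow_carrier_mat[OF R_q_carrier] R_q_carrier that])
  have lt: "(0 :: nat) < 2" "(1 :: nat) < 2" by simp_all
  show ?case
    unfolding step[OF lt(1) lt(1)] step[OF lt(1) lt(2)] step[OF lt(2) lt(1)] step[OF lt(2) lt(2)]
      R_q_index Suc.IH[THEN conjunct1] Suc.IH[THEN conjunct2, THEN conjunct1]
      Suc.IH[THEN conjunct2, THEN conjunct2, THEN conjunct1]
      Suc.IH[THEN conjunct2, THEN conjunct2, THEN conjunct2]
    by (simp only: sum.lessThan_Suc power_Suc2 mult_1_right mult_zero_right mult_zero_left add_0 add_0_right
        add.commute simp_thms)
qed

lemma M_q_Cons_index:
  assumes "c \<ge> 1"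
  shows "M_q (c # cs) $$ (0, 0) =
      (\<Sum>i<c. qvar ^ i) * M_q cs $$ (0, 0) - qvar ^ (c - 1) * M_q cs $$ (1, 0)"
    and "M_q (c # cs) $$ (1, 0) = M_q cs $$ (0, 0)"
proof -
  have lt: "(0 :: nat) < 2" "(1 :: nat) < 2" by simp_all
  have P: "R_q ^\<^sub>m c \<in> carrier_mat 2 2" by (rule pow_carrier_mat[OF R_q_carrier])
  note Q = mult_carrier_mat[OF P S_q_carrier]
  note pow = R_q_pow_index[of c, THEN conjunct1]
    R_q_pow_index[of c, THEN conjunct2, THEN conjunct1]
    R_q_pow_index[of c, THEN conjunct2, THEN conjunct2, THEN conjunct1]
    R_q_pow_index[of c, THEN conjunct2, THEN conjunct2, THEN conjunct2]
  obtain d where d: "c = Suc d" using assms by (cases c) auto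
  have cancel: "qvar ^ c * - inverse qvar = - (qvar ^ (c - 1))"
    unfolding d by simp
  have a: "(R_q ^\<^sub>m c * S_q) $$ (0, 0) = (\<Sum>i<c. qvar ^ i)"
    unfolding mult_mat_2_index[OF P S_q_carrier lt(1) lt(1)] pow S_q_index
    by (simp only: mult_zero_right mult_1_right add_0)
  have b: "(R_q ^\<^sub>m c * S_q) $$ (0, 1) = - (qvar ^ (c - 1))"
    unfolding mult_mat_2_index[OF P S_q_carrier lt(1) lt(2)] pow S_q_index cancel
    by (simp only: mult_zero_right add_0_right)
  have c: "(R_q ^\<^sub>m c * S_q) $$ (1, 0) = 1"
    unfolding mult_mat_2_index[OF P S_q_carrier lt(2) lt(1)] pow S_q_index
    by (simp only: mult_zero_right mult_1_right add_0)
  have d: "(R_q ^\<^sub>m c * S_q) $$ (1, 1) = 0"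
    unfolding mult_mat_2_index[OF P S_q_carrier lt(2) lt(2)] pow S_q_index
    by (simp only: mult_zero_left mult_zero_right add_0)
  show "M_q (c # cs) $$ (0, 0) =
      (\<Sum>i<c. qvar ^ i) * M_q cs $$ (0, 0) - qvar ^ (c - 1) * M_q cs $$ (1, 0)"
    unfolding M_q.simps mult_mat_2_index[OF Q M_q_carrier lt(1) lt(1)] a b
    by (simp only: mult_minus_left diff_conv_add_uminus)
  show "M_q (c # cs) $$ (1, 0) = M_q cs $$ (0, 0)"
    unfolding M_q.simps mult_mat_2_index[OF Q M_q_carrier lt(2) lt(1)] c d
    by (simp only: mult_1 mult_zero_left add_0_right)
qed

lemma M_q_polynomial:
  assumes "\<forall>c\<in>set cs. c \<ge> 2"
  shows "\<exists>P Q. to_fract P = M_q cs $$ (0, 0) \<and> to_fract Q = M_q cs $$ (1, 0)"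
  using assms
proof (induction cs)
  case Nil
  show ?case by (intro exI[of _ 1] exI[of _ 0]) simp
next
  case (Cons c cs)
  have "\<forall>c\<in>set cs. c \<ge> 2" using Cons.prems by simp
  from Cons.IH[OF this] obtain P Q
    where PQ: "to_fract P = M_q cs $$ (0, 0)" "to_fract Q = M_q cs $$ (1, 0)" by (elim exE conjE)
  have pow: "to_fract ([:0, 1:] ^ n) = qvar ^ n" for n
    unfolding qvar_def by (induction n) (simp_all only: power_0 power_Suc to_fract_1 to_fract_mult)
  have sum: "to_fract (\<Sum>i<n. [:0, 1:] ^ i) = (\<Sum>i<n. qvar ^ i)" for n
    by (induction n) (simp_all only: sum.lessThan_Suc lessThan_0 sum.empty to_fract_0 to_fract_add pow)
  have c: "c \<ge> 1" using Cons.prems by simp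
  have "to_fract ((\<Sum>i<c. [:0, 1:] ^ i) * P - [:0, 1:] ^ (c - 1) * Q) = M_q (c # cs) $$ (0, 0)"
    unfolding M_q_Cons_index(1)[OF c] to_fract_diff to_fract_mult pow sum PQ ..
  moreover have "to_fract P = M_q (c # cs) $$ (1, 0)"
    unfolding M_q_Cons_index(2)[OF c] PQ ..
  ultimately show ?case by blast
qed

lemma to_fract_q_numerator_denominator:
  assumes "is_hj_expansion cs x"
  shows "to_fract (q_numerator x) = M_q cs $$ (0, 0)"
    and "to_fract (q_denominator x) = M_q cs $$ (1, 0)"
proof -
  obtain P Q :: "int poly"
    where PQ: "to_fract P = M_q cs $$ (0, 0)" "to_fract Q = M_q cs $$ (1, 0)"
    using M_q_polynomial assms unfolding is_hj_expansion_def by blast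
  have the: "(THE P'. to_fract P' = to_fract P) = P" for P :: "int poly"
    by (rule the_equality) (simp_all only: to_fract_eq_iff)
  show "to_fract (q_numerator x) = M_q cs $$ (0, 0)"
    and "to_fract (q_denominator x) = M_q cs $$ (1, 0)"
    unfolding q_numerator_def q_denominator_def hj_expansion_eqI[OF assms] PQ[symmetric] the
    by (rule refl)+
qed


section \<open>Roots of unity and evaluation\<close>

definition primitive_root_of_unity :: "nat \<Rightarrow> complex \<Rightarrow> bool" where
  "primitive_root_of_unity n z \<longleftrightarrow> n > 0 \<and> z ^ n = 1 \<and> (\<forall>m. 0 < m \<and> m < n \<longrightarrow> z ^ m \<noteq> 1)"

definition eval_at :: "int poly \<Rightarrow> complex \<Rightarrow> complex" where
  "eval_at P z = poly (map_poly of_int P) z"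

end

(* At a primitive sixth root of unity z one has 1 - z = 1/z, so the q-integers collapse to
   [c]_z = z (1 - z^c), and z^3 = -1. Prepending an entry c to an expansion acts on the
   alternating sum T = sum_i (-1)^i z^(-C_i) by T |-> 1 - z^(-c) T, and this matches the action of
   the matrix R_q^c S_q on first columns of the shape (z^(C-2k) T, z^(C-2k-1) (T - 1)). *)

theory Submission
  imports Defs
begin

lemma eval_at_simps [simp]:
  "eval_at 0 z = 0"
  "eval_at 1 z = 1"
  "eval_at [:0, 1:] z = z"
  "eval_at (P + Q) z = eval_at P z + eval_at Q z"
  "eval_at (P - Q) z = eval_at P z - eval_at Q z"
  "eval_at (P * Q) z = eval_at P z * eval_at Q z"
proof -
  have "map_poly complex_of_int (P + Q) = map_poly of_int P + map_poly of_int Q"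
    and "map_poly complex_of_int (P - Q) = map_poly of_int P - map_poly of_int Q"
    and "map_poly complex_of_int (P * Q) = map_poly of_int P * map_poly of_int Q"
    by (rule poly_eqI; simp add: coeff_map_poly coeff_mult)+
  then show "eval_at (P + Q) z = eval_at P z + eval_at Q z"
    and "eval_at (P - Q) z = eval_at P z - eval_at Q z"
    and "eval_at (P * Q) z = eval_at P z * eval_at Q z"
    by (simp_all add: eval_at_def)
qed (simp_all add: eval_at_def map_poly_pCons)

lemma eval_at_power [simp]: "eval_at (P ^ n) z = eval_at P z ^ n"
  by (induction n) simp_all

lemma eval_at_sum [simp]: "eval_at (\<Sum>i\<in>A. f i) z = (\<Sum>i\<in>A. eval_at (f i) z)"
  by (induction A rule: infinite_finite_induct) simp_all

lemma to_fract_X_power: "to_fract ([:0, 1:] ^ n) = qvar ^ n"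
  unfolding qvar_def by (induction n) (simp_all only: power_0 power_Suc to_fract_1 to_fract_mult)

lemma to_fract_sum_X_power: "to_fract (\<Sum>i<n. [:0, 1:] ^ i) = (\<Sum>i<n. qvar ^ i)"
  by (induction n)
    (simp_all only: sum.lessThan_Suc lessThan_0 sum.empty to_fract_0 to_fract_add to_fract_X_power)

text \<open>Of the three factors of \<open>z ^ 6 - 1\<close> used below, only the last, the sixth
  cyclotomic polynomial, can vanish at an element of order 6.\<close>

lemma primitive_sixth_root:
  assumes "primitive_root_of_unity 6 z"
  shows "z ^ 2 = z - 1"
proof -
  have z6: "z ^ 6 = 1" and z3: "z ^ 3 \<noteq> 1" and z2: "z ^ 2 \<noteq> 1"
    using assms unfolding primitive_root_of_unity_def by auto
  have "(z ^ 3 - 1) * (z + 1) * (z ^ 2 - z + 1) = z ^ 6 - 1"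
    by (simp add: algebra_simps eval_nat_numeral)
  \<comment> \<open>Otherwise \<open>z = -1\<close>, which already has order 2.\<close>
  moreover have "z + 1 \<noteq> 0"
    using z2 by (auto simp: add_eq_0_iff2)
  ultimately have "z ^ 2 - z + 1 = 0"
    using z6 z3 by simp
  then have "z ^ 2 - (z - 1) = 0"
    by (simp only: diff_diff_eq2 diff_add_eq)
  then show ?thesis
    by (simp only: right_minus_eq)
qed

text \<open>The hypothesis says \<open>z * (1 - z) = 1\<close>, so dividing by \<open>1 - z\<close>
  in the geometric sum is multiplying by \<open>z\<close>; induction avoids the division.\<close>

lemma q_int_sixth_root:
  fixes z :: complex
  assumes "z ^ 2 = z - 1"
  shows "(\<Sum>i<n. z ^ i) = z * (1 - z ^ n)"
proof (induction n)
  case (Suc n)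
  have "z * (1 - z * z ^ n) = z - z ^ 2 * z ^ n"
    by (simp add: algebra_simps power2_eq_square)
  also have "\<dots> = z * (1 - z ^ n) + z ^ n"
    unfolding assms by (simp add: algebra_simps)
  finally show ?case
    using Suc by simp
qed simp

text \<open>Indexing by prefixes of the list makes the sum recursive in its head. The term at
  \<open>i = 0\<close> is 1, so \<open>alt_sum z cs - 1\<close> is the sum for the
  denominator.\<close>

definition alt_sum :: "complex \<Rightarrow> nat list \<Rightarrow> complex" where
  "alt_sum z cs = (\<Sum>i=0..length cs. (-1) ^ i * z powi (- int (sum_list (take i cs))))"

lemma alt_sum_Nil [simp]: "alt_sum z [] = 1"
  by (simp add: alt_sum_def)

text \<open>Past the initial term, every prefix sum grows by \<open>c\<close> and every index shifts
  by one, which flips the sign.\<close>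

lemma alt_sum_Cons:
  assumes "z \<noteq> 0"
  shows "alt_sum z (c # cs) = 1 - z powi (- int c) * alt_sum z cs"
proof -
  have "alt_sum z (c # cs) =
      1 + (\<Sum>i=0..length cs. - (z powi (- int c) * ((-1) ^ i * z powi (- int (sum_list (take i cs))))))"
    unfolding alt_sum_def using assms
    by (simp add: sum.atLeast0_atMost_Suc_shift power_int_diff power_int_minus divide_simps power_add
        del: sum.cl_ivl_Suc)
  then show ?thesis
    by (simp add: sum_negf sum_distrib_left alt_sum_def)
qed

text \<open>Matrix entries are fractions and cannot be evaluated directly, so the claim is about
  polynomials \<open>P\<close>, \<open>Q\<close> representing them. Both entries are treated
  together because the recursion mixes them.\<close>

lemma M_q_at_sixth_root:
  assumes "\<forall>c\<in>set cs. c \<ge> 2" and z: "z ^ 2 = z - 1"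
    and "to_fract P = M_q cs $$ (0, 0)" "to_fract Q = M_q cs $$ (1, 0)"
  defines "e \<equiv> int (sum_list cs) - 2 * int (length cs)"
  shows "eval_at P z = z powi e * alt_sum z cs"
    and "eval_at Q z = z powi (e - 1) * (alt_sum z cs - 1)"
proof -
  have z0: "z \<noteq> 0"
    using z by auto
  have "eval_at P z = z powi (int (sum_list cs) - 2 * int (length cs)) * alt_sum z cs \<and>
    eval_at Q z = z powi (int (sum_list cs) - 2 * int (length cs) - 1) * (alt_sum z cs - 1)"
    using assms(1,3,4)
  proof (induction cs arbitrary: P Q)
    case Nil
    then have "to_fract P = to_fract 1" "to_fract Q = to_fract 0"
      by (simp_all)
    then have "P = 1" "Q = 0"
      by (simp_all only: to_fract_eq_iff)
    then show ?case
      by simp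
  next
    case (Cons c cs)
    have cs: "\<forall>c\<in>set cs. c \<ge> 2" and c2: "c \<ge> 2"
      using Cons.prems(1) by simp_all
    then have c: "c \<ge> 1"
      by simp
    obtain P' Q' where PQ: "to_fract P' = M_q cs $$ (0, 0)" "to_fract Q' = M_q cs $$ (1, 0)"
      using M_q_polynomial[OF cs] by blast
    \<comment> \<open>Injectivity of \<open>to_fract\<close> brings the matrix recursion down to
      polynomials, where evaluation applies.\<close>
    have "to_fract P = to_fract ((\<Sum>i<c. [:0, 1:] ^ i) * P' - [:0, 1:] ^ (c - 1) * Q')"
      unfolding Cons.prems(2) M_q_Cons_index(1)[OF c] to_fract_diff to_fract_mult
        to_fract_X_power to_fract_sum_X_power PQ ..
    then have P: "P = (\<Sum>i<c. [:0, 1:] ^ i) * P' - [:0, 1:] ^ (c - 1) * Q'"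
      by (simp only: to_fract_eq_iff)
    have "to_fract Q = to_fract P'"
      unfolding Cons.prems(3) M_q_Cons_index(2)[OF c] PQ ..
    then have Q: "Q = P'"
      by (simp only: to_fract_eq_iff)
    define u where "u = z powi (int (sum_list cs) - 2 * int (length cs))"
    define t where "t = alt_sum z cs"
    have IH: "eval_at P' z = u * t" "eval_at Q' z = u / z * (t - 1)"
      using Cons.IH[OF cs PQ] z0 by (simp_all add: u_def t_def power_int_diff)
    obtain d where d: "c = Suc d"
      using c by (cases c) auto
    \<comment> \<open>The new entry adds \<open>c\<close> to the total and 1 to the length, hence
      the factor \<open>z ^ c / z ^ 2\<close>.\<close>
    have e: "int (sum_list (c # cs)) - 2 * int (length (c # cs)) =
        (int (sum_list cs) - 2 * int (length cs)) + int c - 2"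
      by simp
    have u': "z powi (int (sum_list (c # cs)) - 2 * int (length (c # cs))) = u * z ^ c / z ^ 2"
      unfolding e u_def using z0 by (simp add: power_int_add power_int_diff)
    have t': "alt_sum z (c # cs) = 1 - t / z ^ c"
      unfolding alt_sum_Cons[OF z0] t_def by (simp add: power_int_minus divide_inverse)
    have inv: "1 / z = 1 - z"
      using z z0 by (simp add: field_simps power2_eq_square)
    have "eval_at P z = z * (1 - z ^ c) * (u * t) - z ^ d * (u / z * (t - 1))"
      unfolding P using IH by (simp add: q_int_sixth_root[OF z] d del: sum.lessThan_Suc)
    also have "\<dots> = (z - z ^ 2 * z ^ d) * (u * t) - z ^ d * (u * (1 / z) * (t - 1))"
      by (simp add: d algebra_simps power2_eq_square)
    \<comment> \<open>The terms in \<open>u * t * z ^ d\<close> cancel, since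
      \<open>z ^ 2 + 1 / z = 0\<close>. The remaining coefficient \<open>z\<close> of
      \<open>u * t\<close> is written as \<open>- (1 - z) ^ 2\<close>, that is
      \<open>- (1 / z) ^ 2\<close>.\<close>
    also have "\<dots> = u * z ^ d * (1 / z) - u * t * (1 - 2 * z + z ^ 2)"
      unfolding inv z by (simp add: algebra_simps)
    also have "1 - 2 * z + z ^ 2 = (1 / z) ^ 2"
      unfolding inv by (simp add: algebra_simps power2_eq_square)
    also have "u * z ^ d * (1 / z) - u * t * (1 / z) ^ 2 = u * z ^ c / z ^ 2 * (1 - t / z ^ c)"
      using z0 by (simp add: d field_simps power2_eq_square)
    finally have 1: "eval_at P z = u * z ^ c / z ^ 2 * (1 - t / z ^ c)" .
    \<comment> \<open>The target for \<open>Q\<close> collapses to \<open>- u * t / z ^ 3\<close>,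
      which equals \<open>u * t\<close>, the value of \<open>P'\<close>, once
      \<open>z ^ 3 = -1\<close>.\<close>
    have "z ^ 3 = z * z ^ 2"
      by (simp add: eval_nat_numeral)
    also have "\<dots> = z ^ 2 - z"
      unfolding z by (simp add: z right_diff_distrib flip: power2_eq_square)
    also have "\<dots> = -1"
      by (simp add: z)
    finally have "z ^ 3 = -1" .
    then have "eval_at Q z = u * z ^ c / z ^ 2 / z * (1 - t / z ^ c - 1)"
      unfolding Q IH using z0 by (simp add: field_simps power2_eq_square power3_eq_cube)
    moreover have "z powi (m - 1) = z powi m / z" for m
      using z0 by (simp add: power_int_diff)
    ultimately show ?case
      using 1 by (simp only: u' t' simp_thms)
  qed
  then show "eval_at P z = z powi e * alt_sum z cs"
    and "eval_at Q z = z powi (e - 1) * (alt_sum z cs - 1)"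
    unfolding e_def by simp_all
qed

theorem theorem1p5:
  fixes \<zeta> :: complex and r s :: int and c :: "nat list" and k :: nat and C :: "nat \<Rightarrow> int"
  assumes "primitive_root_of_unity 6 \<zeta>"
    and "coprime r s"
    and "(of_int r / of_int s :: rat) > 1"
    and "is_hj_expansion c (of_int r / of_int s)"
    and "length c = k"
    and "\<And>i. i \<le> k \<Longrightarrow> C i = (\<Sum>j<i. int (c ! j))"
  shows "eval_at (q_numerator (of_int r / of_int s)) \<zeta> =
           \<zeta> powi (C k - 2 * int k) * (\<Sum>i=0..k. (-1) ^ i * \<zeta> powi (- C i)) \<and>
         eval_at (q_denominator (of_int r / of_int s)) \<zeta> =
           \<zeta> powi (C k - 2 * int k - 1) * (\<Sum>i=1..k. (-1) ^ i * \<zeta> powi (- C i))"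
proof -
  have z: "\<zeta> ^ 2 = \<zeta> - 1"
    by (rule primitive_sixth_root[OF assms(1)])
  have ge2: "\<forall>d\<in>set c. d \<ge> 2"
    using assms(4) unfolding is_hj_expansion_def by simp
  have C: "C i = int (sum_list (take i c))" if "i \<le> k" for i
    using that assms(5,6) by (simp add: sum_list_sum_nth atLeast0LessThan)
  have T: "alt_sum \<zeta> c = (\<Sum>i=0..k. (-1) ^ i * \<zeta> powi (- C i))"
    unfolding alt_sum_def assms(5) by (intro sum.cong refl) (simp add: C)
  \<comment> \<open>The empty sum gives \<open>C 0 = 0\<close>, so the split-off term is 1.\<close>
  also have "\<dots> = 1 + (\<Sum>i=1..k. (-1) ^ i * \<zeta> powi (- C i))"
    using assms(6)[of 0] by (simp add: sum.atLeast_Suc_atMost)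
  finally have T': "alt_sum \<zeta> c - 1 = (\<Sum>i=1..k. (-1) ^ i * \<zeta> powi (- C i))"
    by simp
  have "C k = int (sum_list c)"
    using C[of k] assms(5) by simp
  then show ?thesis
    using M_q_at_sixth_root[OF ge2 z to_fract_q_numerator_denominator[OF assms(4)]]
    unfolding assms(5) T[symmetric] T'[symmetric] by simp
qed

end
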